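(* There is a constant $c = 0.170934\cdots$ (that is, a real number $c$ with $0.170934 \leq c < 0.170935$) such that, if $A \subset \mathbf{Z}$ is a finite set of size $N$, then $$\|\widehat{1_A}\|_1 \geq (c - o(1)) \log N,$$ where $o(1)$ denotes a quantity tending to $0$ as $N \to \infty$, uniformly over all sets $A$ of size $N$. Equivalently, for every $\varepsilon > 0$ there is $N_0(\varepsilon)$ such that $\|\widehat{1_A}\|_1 \geq (c - \varepsilon)\log N$ for every $N \geq N_0(\varepsilon)$ and every $A \subset \mathbf{Z}$ with $|A| = N$.
   Context: For a finite set $A \subset \mathbf{Z}$, $1_A$ is its indicator function, $\widehat{1_A}(\theta) = \sum_{n \in A} e^{-2\pi i n\theta}$ for $\theta \in \mathbf{R}/\mathbf{Z}$, and $\|\widehat{1_A}\|_1 = \int_0^1 |\widehat{1_A}(\theta)|\,d\theta$. $\log$ is the natural logarithm. *)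

theory Defs
  imports "HOL-Analysis.Analysis"
begin

(* A function on R/Z is represented by its 1-periodic lift to the reals. *)
definition indicator_hat :: "int set \<Rightarrow> real \<Rightarrow> complex" where
  "indicator_hat A \<theta> =
     (\<Sum>n\<in>A. exp (- (2 * complex_of_real pi * \<i> * of_int n * complex_of_real \<theta>)))"

definition circle_L1_norm :: "(real \<Rightarrow> complex) \<Rightarrow> real" where
  "circle_L1_norm f = integral {0..1} (\<lambda>\<theta>. cmod (f \<theta>))"

end

theory Submission
  imports Defs "HOL-Complex_Analysis.Complex_Analysis"
begin

text \<open>The proof is a quantitative form of the argument of McGehee, Pigno and Smith. Let
  \<open>g z = (\<Sum>n\<in>A. z powi n)\<close>, split the least elements of \<open>A\<close> into consecutive blocks \<open>S k\<close> of size
  \<open>64 ^ k\<close>, and let \<open>f k\<close> be the conjugate of the average of \<open>z powi n\<close> over \<open>S k\<close>. Put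
  \<open>F = d * (\<Sum>j. f j * P j)\<close>, where \<open>d = 15 / 16\<close> and \<open>P j = exp (- (\<Sum>k>j. K k))\<close> for entire functions
  \<open>K k\<close> whose real part on the unit circle is, up to a tiny error, \<open>- ln (1 - d * cmod (f k))\<close>.
  Adding one block at a time shows \<open>cmod F \<le> 1\<close>. As \<open>P j\<close> has no negative frequencies, the
  elements of \<open>A\<close> above \<open>S j\<close> do not contribute to the mean of \<open>f j * P j * g\<close>.

  The gain over the classical estimates comes from treating the contribution of \<open>S j\<close> itself
  separately: it is \<open>64 ^ j\<close> times the mean of \<open>(cmod (f j))\<^sup>2 * P j\<close>, and
  \<open>2 * (1 - Re P) = (cmod (1 - P))\<^sup>2 + (1 - (cmod P)\<^sup>2)\<close>. Bounding \<open>g\<close> by its square mean is then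
  needed only for the elements below \<open>S j\<close>, whose number is about \<open>64 ^ j / 63\<close>. Moreover, with \<open>q = - ln (cmod (P j))\<close>, the
  mean of \<open>(cmod (1 - P j))\<^sup>2\<close> is at most that of \<open>exp (- 2 * q) - 1 + 2 * q\<close>, which grows only linearly
  in \<open>q\<close>. Each block contributes at least \<open>15 / 16 * 0.78\<close>, and there are about
  \<open>ln N / ln 64\<close> blocks.\<close>

section \<open>Averages over the unit circle\<close>

definition circle_mean :: "(complex \<Rightarrow> 'a::banach) \<Rightarrow> 'a" where
  "circle_mean f = integral {0..1} (\<lambda>t. f (cis (2 * pi * t)))"

lemma circle_integrable:
  fixes f :: "complex \<Rightarrow> 'a::banach"
  assumes "continuous_on (sphere 0 1) f"
  shows "(\<lambda>t. f (cis (2 * pi * t))) integrable_on {0..1}"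
proof (rule integrable_continuous_real)
  have "continuous_on {0..1} (\<lambda>t. cis (2 * pi * t))"
    by (intro continuous_intros)
  then show "continuous_on {0..1} (\<lambda>t. f (cis (2 * pi * t)))"
    by (rule continuous_on_compose2[OF assms]) auto
qed

lemma circle_mean_cong:
  assumes "\<And>z. cmod z = 1 \<Longrightarrow> f z = g z"
  shows "circle_mean f = circle_mean g"
  unfolding circle_mean_def by (intro integral_cong assms) simp

lemma circle_mean_const [simp]: "circle_mean (\<lambda>z. c) = c"
  by (simp add: circle_mean_def)

lemma circle_mean_add:
  fixes f g :: "complex \<Rightarrow> 'a::banach"
  assumes "continuous_on (sphere 0 1) f" "continuous_on (sphere 0 1) g"
  shows "circle_mean (\<lambda>z. f z + g z) = circle_mean f + circle_mean g"
  unfolding circle_mean_def by (intro integral_add circle_integrable assms)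

lemma circle_mean_diff:
  fixes f g :: "complex \<Rightarrow> 'a::banach"
  assumes "continuous_on (sphere 0 1) f" "continuous_on (sphere 0 1) g"
  shows "circle_mean (\<lambda>z. f z - g z) = circle_mean f - circle_mean g"
  unfolding circle_mean_def by (intro integral_diff circle_integrable assms)

lemma circle_mean_mult:
  fixes f :: "complex \<Rightarrow> 'a::{banach, real_normed_field}"
  shows "circle_mean (\<lambda>z. c * f z) = c * circle_mean f"
  unfolding circle_mean_def by simp

lemma circle_mean_sum:
  fixes f :: "'b \<Rightarrow> complex \<Rightarrow> 'a::banach"
  assumes "finite I" "\<And>i. i \<in> I \<Longrightarrow> continuous_on (sphere 0 1) (f i)"
  shows "circle_mean (\<lambda>z. \<Sum>i\<in>I. f i z) = (\<Sum>i\<in>I. circle_mean (f i))"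
  unfolding circle_mean_def by (intro integral_sum circle_integrable assms)

lemma circle_mean_mono:
  fixes f g :: "complex \<Rightarrow> real"
  assumes "continuous_on (sphere 0 1) f" "continuous_on (sphere 0 1) g"
    and "\<And>z. cmod z = 1 \<Longrightarrow> f z \<le> g z"
  shows "circle_mean f \<le> circle_mean g"
  unfolding circle_mean_def by (intro integral_le circle_integrable assms) simp

lemma Re_circle_mean:
  assumes "continuous_on (sphere 0 1) f"
  shows "Re (circle_mean f) = circle_mean (\<lambda>z. Re (f z))"
  unfolding circle_mean_def
  using integral_linear[OF circle_integrable[OF assms] bounded_linear_Re] by (simp add: o_def)

lemma cnj_circle_mean: "cnj (circle_mean f) = circle_mean (\<lambda>z. cnj (f z))"
  unfolding circle_mean_def by (rule integral_cnj)

lemma norm_circle_mean_le: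
  fixes f :: "complex \<Rightarrow> 'a::banach"
  assumes "continuous_on (sphere 0 1) f"
  shows "norm (circle_mean f) \<le> circle_mean (\<lambda>z. norm (f z))"
  unfolding circle_mean_def
  by (rule integral_norm_bound_integral[OF circle_integrable circle_integrable])
     (auto intro!: assms continuous_intros)

text \<open>Cauchy's integral formula at the centre: on the unit circle \<open>dz / z\<close>
  becomes \<open>2 * pi * \<i> * dt\<close>.\<close>

lemma circle_mean_holomorphic:
  assumes "f holomorphic_on UNIV"
  shows "circle_mean f = f 0"
proof -
  have "((\<lambda>u. f u / (u - 0)) has_contour_integral (2 * of_real pi * \<i> * f 0)) (circlepath 0 1)"
    by (rule Cauchy_integral_circlepath_simple) (use assms holomorphic_on_subset in auto)
  then have "((\<lambda>t. f (circlepath 0 1 t) / circlepath 0 1 t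
                 * vector_derivative (circlepath 0 1) (at t within {0..1}))
              has_integral (2 * of_real pi * \<i> * f 0)) {0..1}"
    by (simp add: has_contour_integral_def)
  then have "((\<lambda>t. (2 * of_real pi * \<i>) * f (cis (2 * pi * t)))
              has_integral ((2 * of_real pi * \<i>) * f 0)) {0..1}"
  proof (rule has_integral_eq[rotated])
    fix t :: real
    assume t: "t \<in> {0..1}"
    have e: "circlepath 0 1 t = cis (2 * pi * t)"
      by (simp add: circlepath cis_conv_exp mult_ac)
    have "vector_derivative (circlepath 0 1) (at t within {0..1}) = 2 * of_real pi * \<i> * cis (2 * pi * t)"
      using t by (simp add: vector_derivative_circlepath01 cis_conv_exp mult_ac)
    then show "f (circlepath 0 1 t) / circlepath 0 1 t
        * vector_derivative (circlepath 0 1) (at t within {0..1})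
        = (2 * of_real pi * \<i>) * f (cis (2 * pi * t))"
      unfolding e by simp
  qed
  from has_integral_mult_right[OF this, of "1 / (2 * of_real pi * \<i>)"]
  have "((\<lambda>t. f (cis (2 * pi * t))) has_integral f 0) {0..1}"
    by simp
  then show ?thesis
    by (simp add: circle_mean_def integral_unique)
qed

section \<open>Approximation by real parts of entire functions\<close>

text \<open>Real parts of complex polynomials. Products are not a constructor: they stay in the
  class only up to equality on the unit circle.\<close>

inductive harmonic_poly :: "(complex \<Rightarrow> real) \<Rightarrow> bool" where
  monom: "harmonic_poly (\<lambda>z. Re (a * z ^ n))"
| add: "harmonic_poly f \<Longrightarrow> harmonic_poly g \<Longrightarrow> harmonic_poly (\<lambda>z. f z + g z)"

lemma unit_power_mult_cnj_power:
  assumes "cmod z = 1"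
  shows "z ^ (m + k) * cnj z ^ k = z ^ m"
proof -
  have "z * cnj z = 1"
    using assms by (simp add: complex_norm_square[symmetric])
  then have "z ^ k * cnj z ^ k = 1"
    by (simp flip: power_mult_distrib)
  then show ?thesis
    by (simp add: power_add mult.assoc)
qed

text \<open>\<open>Re v * Re w\<close> splits into \<open>Re (v * w) / 2\<close> and
  \<open>Re (v * cnj w) / 2\<close>. On the circle \<open>cnj z\<close> is \<open>1 / z\<close>, so
  the second term has exponent \<open>m - n\<close>; if that is negative, conjugation makes it
  positive without changing the real part.\<close>

lemma harmonic_poly_monom_mult_monom:
  "\<exists>h. harmonic_poly h \<and> (\<forall>z. cmod z = 1 \<longrightarrow> Re (a * z ^ m) * Re (b * z ^ n) = h z)"
proof -
  have prod: "Re v * Re w = Re (v * w / 2) + Re (v * cnj w / 2)" for v w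
    by (simp add: field_simps)
  have "\<exists>c k. \<forall>z. cmod z = 1 \<longrightarrow> Re ((a * z ^ m) * cnj (b * z ^ n)) = Re (c * z ^ k)"
  proof (cases "n \<le> m")
    case True
    then obtain k where m: "m = k + n"
      by (metis add.commute le_iff_add)
    have "(a * z ^ m) * cnj (b * z ^ n) = (a * cnj b) * z ^ k" if "cmod z = 1" for z
      using unit_power_mult_cnj_power[OF that, of k n] by (simp add: m mult_ac)
    then show ?thesis
      by metis
  next
    case False
    then obtain k where n: "n = k + m"
      by (metis add.commute le_iff_add nat_le_linear)
    have "cnj ((a * z ^ m) * cnj (b * z ^ n)) = (cnj a * b) * z ^ k" if "cmod z = 1" for z
      using unit_power_mult_cnj_power[OF that, of k m] by (simp add: n mult_ac)
    then show ?thesis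
      by (metis complex_cnj_cnj complex_cnj(1) cnj.sel(1))
  qed
  then obtain c k where c: "\<And>z. cmod z = 1 \<Longrightarrow> Re ((a * z ^ m) * cnj (b * z ^ n)) = Re (c * z ^ k)"
    by metis
  have "Re (a * z ^ m) * Re (b * z ^ n) = Re (a * b / 2 * z ^ (m + n)) + Re (c / 2 * z ^ k)"
    if "cmod z = 1" for z
  proof -
    have "Re ((a * z ^ m) * cnj (b * z ^ n) / 2) = Re (c * z ^ k) / 2"
      using c[OF that] by simp
    moreover have "(a * z ^ m) * (b * z ^ n) / 2 = a * b / 2 * z ^ (m + n)"
      by (simp add: power_add)
    moreover have "Re (c / 2 * z ^ k) = Re (c * z ^ k) / 2"
      by simp
    ultimately show ?thesis
      by (simp only: prod[of "a * z ^ m" "b * z ^ n"])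
  qed
  moreover have "harmonic_poly (\<lambda>z. Re (a * b / 2 * z ^ (m + n)) + Re (c / 2 * z ^ k))"
    by (intro harmonic_poly.intros)
  ultimately show ?thesis
    by (intro exI[of _ "\<lambda>z. Re (a * b / 2 * z ^ (m + n)) + Re (c / 2 * z ^ k)"]) blast
qed

lemma harmonic_poly_mult:
  assumes "harmonic_poly f" "harmonic_poly g"
  shows "\<exists>h. harmonic_poly h \<and> (\<forall>z. cmod z = 1 \<longrightarrow> f z * g z = h z)"
  using assms(1)
proof (induction rule: harmonic_poly.induct)
  case (monom a n)
  show ?case
    using assms(2)
  proof (induction rule: harmonic_poly.induct)
    case (monom b m)
    show ?case by (rule harmonic_poly_monom_mult_monom)
  next
    case (add g1 g2)
    then obtain h1 h2 where "harmonic_poly h1" "\<forall>z. cmod z = 1 \<longrightarrow> Re (a * z ^ n) * g1 z = h1 z"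
      "harmonic_poly h2" "\<forall>z. cmod z = 1 \<longrightarrow> Re (a * z ^ n) * g2 z = h2 z"
      by blast
    then show ?case
      by (intro exI[of _ "\<lambda>z. h1 z + h2 z"]) (simp add: harmonic_poly.add distrib_left)
  qed
next
  case (add f1 f2)
  then obtain h1 h2 where "harmonic_poly h1" "\<forall>z. cmod z = 1 \<longrightarrow> f1 z * g z = h1 z"
    "harmonic_poly h2" "\<forall>z. cmod z = 1 \<longrightarrow> f2 z * g z = h2 z"
    by blast
  then show ?case
    by (intro exI[of _ "\<lambda>z. h1 z + h2 z"]) (simp add: harmonic_poly.add distrib_right)
qed

lemma real_polynomial_function_imp_harmonic_poly:
  fixes p :: "complex \<Rightarrow> real"
  assumes "real_polynomial_function p"
  shows "\<exists>h. harmonic_poly h \<and> (\<forall>z. cmod z = 1 \<longrightarrow> p z = h z)"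
  using assms
proof (induction rule: real_polynomial_function.induct)
  case (linear p)
  interpret bounded_linear p by fact
  \<comment> \<open>A real-linear form on the plane is determined by its values at \<open>1\<close>
    and \<open>\<i>\<close>.\<close>
  have "p z = Re (Complex (p 1) (- p \<i>) * z ^ 1)" for z
  proof -
    have "p z = p (Re z *\<^sub>R 1 + Im z *\<^sub>R \<i>)"
      by (rule arg_cong[of _ _ p]) (simp add: complex_eq_iff)
    also have "\<dots> = Re z * p 1 + Im z * p \<i>"
      by (simp only: add scaleR) simp
    finally show ?thesis by simp
  qed
  then show ?case
    by (intro exI[of _ "\<lambda>z. Re (Complex (p 1) (- p \<i>) * z ^ 1)"])
       (use harmonic_poly.monom in blast)
next
  case (const c)
  then show ?case
    using harmonic_poly.monom[of "of_real c" 0] by (intro exI[of _ "\<lambda>z. c"]) simp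
next
  case (add f g)
  then show ?case
    by (metis (mono_tags, lifting) harmonic_poly.add)
next
  case (mult f g)
  then obtain h1 h2 where "harmonic_poly h1" "harmonic_poly h2"
    "\<forall>z. cmod z = 1 \<longrightarrow> f z = h1 z" "\<forall>z. cmod z = 1 \<longrightarrow> g z = h2 z"
    by blast
  then show ?case
    using harmonic_poly_mult[of h1 h2] by simp
qed

lemma harmonic_poly_eq_Re_entire:
  assumes "harmonic_poly h"
  shows "\<exists>K. K holomorphic_on UNIV \<and> (\<forall>z. h z = Re (K z))"
  using assms
proof (induction rule: harmonic_poly.induct)
  case (monom a n)
  have "(\<lambda>z. a * z ^ n) holomorphic_on UNIV"
    by (intro holomorphic_intros)
  then show ?case by metis
next
  case (add f g)
  then obtain K L where "K holomorphic_on UNIV" "\<forall>z. f z = Re (K z)"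
    "L holomorphic_on UNIV" "\<forall>z. g z = Re (L z)" by blast
  then show ?case
    by (intro exI[of _ "\<lambda>z. K z + L z"]) (simp add: holomorphic_intros)
qed

text \<open>Stone-Weierstrass gives a polynomial in the real and imaginary parts, which on the
  circle is the real part of an entire function. This takes the place of a harmonic conjugate of
  \<open>u\<close>.\<close>

lemma entire_Re_approx:
  fixes u :: "complex \<Rightarrow> real"
  assumes "continuous_on (sphere 0 1) u" "0 < \<eta>"
  obtains K where "K holomorphic_on UNIV" "Im (K 0) = 0"
    "\<And>z. cmod z = 1 \<Longrightarrow> u z \<le> Re (K z)"
    "\<And>z. cmod z = 1 \<Longrightarrow> Re (K z) \<le> u z + \<eta>"
proof -
  \<comment> \<open>Raising the target by half of \<open>\<eta>\<close> turns a two-sided error into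
    the two one-sided bounds.\<close>
  have "continuous_on (sphere 0 1) (\<lambda>z. u z + \<eta> / 2)"
    by (intro continuous_intros assms)
  then obtain p where p: "real_polynomial_function p"
    "\<And>z. z \<in> sphere 0 1 \<Longrightarrow> \<bar>(u z + \<eta> / 2) - p z\<bar> < \<eta> / 2"
    using Stone_Weierstrass_real_polynomial_function[of "sphere 0 1" "\<lambda>z. u z + \<eta> / 2" "\<eta> / 2"]
      \<open>0 < \<eta>\<close> compact_sphere half_gt_zero by blast
  obtain L where L: "L holomorphic_on UNIV" "\<And>z. cmod z = 1 \<Longrightarrow> p z = Re (L z)"
    using real_polynomial_function_imp_harmonic_poly[OF p(1)] harmonic_poly_eq_Re_entire by metis
  have approx: "u z \<le> Re (L z) \<and> Re (L z) \<le> u z + \<eta>" if "cmod z = 1" for z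
    using p(2)[of z] L(2)[OF that] that unfolding abs_less_iff by (simp add: field_simps)
  show thesis
  \<comment> \<open>The imaginary constant makes the value at \<open>0\<close> real and leaves real
    parts unchanged.\<close>
  proof (rule that[of "\<lambda>z. L z - \<i> * Im (L 0)"])
    show "(\<lambda>z. L z - \<i> * Im (L 0)) holomorphic_on UNIV"
      by (intro holomorphic_intros L)
  qed (use approx in auto)
qed

section \<open>The function \<open>exp (- 2 * a) - 1 + 2 * a\<close>\<close>

text \<open>For \<open>a = Re K\<close> this is
  \<open>(cmod (exp (- K)))\<^sup>2 - 1 + 2 * Re K\<close>, with \<open>exp (- K)\<close> in the
  role of an outer function of prescribed modulus. It behaves like \<open>2 * a\<^sup>2\<close> near
  \<open>0\<close>.\<close>

definition outer_defect :: "real \<Rightarrow> real" where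
  "outer_defect a = exp (- 2 * a) - 1 + 2 * a"

text \<open>The mean value property gives the mean \<open>exp (- K 0)\<close> of \<open>exp (- K)\<close>, and
  \<open>exp (- K 0) \<ge> 1 - K 0\<close>, where \<open>K 0\<close> is the mean of \<open>Re K\<close>.\<close>

lemma circle_mean_one_minus_exp:
  assumes K: "K holomorphic_on UNIV" "Im (K 0) = 0"
  shows "circle_mean (\<lambda>z. (cmod (1 - exp (- K z)))\<^sup>2) \<le> circle_mean (\<lambda>z. outer_defect (Re (K z)))"
proof -
  have contK [continuous_intros]: "continuous_on (sphere 0 1) K"
    using K holomorphic_on_imp_continuous_on continuous_on_subset by blast
  have "circle_mean (\<lambda>z. exp (- K z)) = exp (- K 0)"
    by (rule circle_mean_holomorphic) (intro holomorphic_intros K)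
  then have "circle_mean (\<lambda>z. Re (exp (- K z))) = exp (- Re (K 0))"
    using Re_circle_mean[of "\<lambda>z. exp (- K z)"] K(2) by (simp add: continuous_intros Re_exp)
  moreover have "circle_mean (\<lambda>z. Re (K z)) = Re (K 0)"
    using Re_circle_mean[of K] circle_mean_holomorphic[OF K(1)] contK by simp
  moreover have "exp (- Re (K 0)) \<ge> 1 - Re (K 0)"
    using exp_ge_add_one_self[of "- Re (K 0)"] by simp
  ultimately have *: "circle_mean (\<lambda>z. Re (exp (- K z))) \<ge> 1 - circle_mean (\<lambda>z. Re (K z))"
    by simp
  \<comment> \<open>The bracket collects what exceeds \<open>outer_defect\<close>; by
    \<open>*\<close> its mean is at most \<open>0\<close>.\<close>
  have "(cmod (1 - exp (- K z)))\<^sup>2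
          = outer_defect (Re (K z)) + (2 - 2 * Re (K z) - 2 * Re (exp (- K z)))" for z
  proof -
    have "(cmod (1 - w))\<^sup>2 = 1 - 2 * Re w + (cmod w)\<^sup>2" for w
      unfolding cmod_power2 by (simp add: power2_eq_square algebra_simps)
    moreover have "(cmod (exp (- K z)))\<^sup>2 = exp (- 2 * Re (K z))"
      by (simp add: norm_exp_eq_Re flip: exp_double)
    ultimately show ?thesis
      by (simp add: outer_defect_def)
  qed
  then have "circle_mean (\<lambda>z. (cmod (1 - exp (- K z)))\<^sup>2)
      = circle_mean (\<lambda>z. outer_defect (Re (K z)) + (2 - 2 * Re (K z) - 2 * Re (exp (- K z))))"
    by simp
  also have "\<dots> = circle_mean (\<lambda>z. outer_defect (Re (K z)))
      + (2 - 2 * circle_mean (\<lambda>z. Re (K z)) - 2 * circle_mean (\<lambda>z. Re (exp (- K z))))"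
    unfolding outer_defect_def
    by (subst circle_mean_add circle_mean_diff circle_mean_mult circle_mean_const; 
        (intro continuous_intros)?)+ simp
  finally show ?thesis
    using * by simp
qed

text \<open>Additivity fails only by a product of two factors of the form
  \<open>1 - exp (- 2 * a)\<close>, so a sum can be treated one summand at a time.\<close>

lemma outer_defect_add:
  "outer_defect (a + b) = outer_defect a + outer_defect b + (1 - exp (- 2 * a)) * (1 - exp (- 2 * b))"
  by (simp add: outer_defect_def algebra_simps exp_add[symmetric] exp_diff exp_minus)
     (simp add: field_simps exp_add)

text \<open>Absorbs the approximation error in the real parts of the \<open>K k\<close>.\<close>

lemma outer_defect_add_le:
  assumes "0 \<le> b"
  shows "outer_defect (a + b) \<le> outer_defect a + 2 * b"
proof -
  have "exp (- 2 * (a + b)) \<le> exp (- 2 * a)"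
    using assms by simp
  then show ?thesis
    unfolding outer_defect_def by (simp add: algebra_simps)
qed

text \<open>The power series of \<open>- ln (1 - t) - t\<close> starts at
  \<open>t\<^sup>2 / 2\<close> and has nonnegative coefficients, and
  \<open>x ^ n \<le> x\<^sup>2\<close> for \<open>n \<ge> 2\<close>.\<close>

lemma neg_ln_one_minus_scale:
  fixes d x :: real
  assumes "0 \<le> d" "d < 1" "0 \<le> x" "x \<le> 1"
  shows "- ln (1 - d * x) - d * x \<le> x\<^sup>2 * (- ln (1 - d) - d)"
proof -
  \<comment> \<open>The term at \<open>n = 0\<close> is \<open>0\<close> because division by zero
    yields \<open>0\<close>.\<close>
  have sums: "(\<lambda>n. t ^ n / real n - (if n = 1 then t else 0)) sums (- ln (1 - t) - t)"
    if "0 \<le> t" "t < 1" for t :: real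
    using sums_diff[OF sums_minus[OF ln_series'[of "- t"]] sums_single[of 1 "\<lambda>_. t"]] that
    by simp
  have dx: "0 \<le> d * x" "d * x < 1"
    using assms by (auto intro: le_less_trans[OF mult_left_le])
  show ?thesis
  proof (rule sums_le[OF _ sums[OF dx] sums_mult[OF sums[OF assms(1,2)]]])
    fix n :: nat
    show "(d * x) ^ n / real n - (if n = 1 then d * x else 0)
            \<le> x\<^sup>2 * (d ^ n / real n - (if n = 1 then d else 0))"
    proof (cases "n \<le> 1")
      case True
      then show ?thesis
        by (cases n) auto
    next
      case False
      then have "x ^ n \<le> x\<^sup>2"
        using assms by (intro power_decreasing) auto
      then have "x ^ n * (d ^ n / real n) \<le> x\<^sup>2 * (d ^ n / real n)"
        using assms by (intro mult_right_mono) auto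
      then show ?thesis
        using False by (simp add: power_mult_distrib mult_ac)
    qed
  qed
qed

lemma outer_defect_neg_ln:
  assumes "t < 1"
  shows "outer_defect (- ln (1 - t)) = t\<^sup>2 + 2 * (- ln (1 - t) - t)"
proof -
  have "exp (- 2 * (- ln (1 - t))) = (1 - t)\<^sup>2"
    using assms exp_double[of "ln (1 - t)"] by simp
  then show ?thesis
    by (simp add: outer_defect_def power2_eq_square algebra_simps)
qed

text \<open>The square in \<open>outer_defect_neg_ln\<close> scales exactly and the logarithmic
  remainder by its series. The factor \<open>x\<^sup>2\<close> has a mean given by
  orthogonality.\<close>

lemma outer_defect_neg_ln_scale:
  fixes d x :: real
  assumes "0 \<le> d" "d < 1" "0 \<le> x" "x \<le> 1"
  shows "outer_defect (- ln (1 - d * x)) \<le> outer_defect (- ln (1 - d)) * x\<^sup>2"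
proof -
  have "d * x < 1"
    using assms by (auto intro: le_less_trans[OF mult_left_le])
  then show ?thesis
    using neg_ln_one_minus_scale[OF assms] assms
    by (simp add: outer_defect_neg_ln power_mult_distrib algebra_simps)
qed

lemma one_minus_exp_neg_ln_le:
  fixes d x :: real
  assumes "0 \<le> d" "d < 1" "0 \<le> x" "x \<le> 1"
  shows "1 - exp (- 2 * (- ln (1 - d * x))) \<le> 2 * d * x"
proof -
  have "d * x < 1"
    using assms by (auto intro: le_less_trans[OF mult_left_le])
  then have "exp (- 2 * (- ln (1 - d * x))) = (1 - d * x)\<^sup>2"
    using exp_double[of "ln (1 - d * x)"] by simp
  moreover have "0 \<le> (d * x)\<^sup>2"
    by simp
  ultimately show ?thesis
    by (simp add: power2_eq_square algebra_simps)
qed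

lemma neg_ln_one_minus_nonneg:
  fixes d x :: real
  assumes "0 \<le> d" "d < 1" "0 \<le> x" "x \<le> 1"
  shows "0 \<le> - ln (1 - d * x)"
proof -
  have "d * x < 1"
    using assms by (auto intro: le_less_trans[OF mult_left_le])
  moreover have "0 \<le> d * x"
    using assms by simp
  ultimately show ?thesis
    by simp
qed

text \<open>Iterates \<open>1 - u * v \<le> (1 - u) + (1 - v)\<close> for \<open>u\<close> and
  \<open>v\<close> in the unit interval.\<close>

lemma one_minus_exp_sum_le:
  fixes d :: real and x :: "'i \<Rightarrow> real"
  assumes d: "0 \<le> d" "d < 1" and I: "finite I"
    and x: "\<And>i. i \<in> I \<Longrightarrow> 0 \<le> x i" "\<And>i. i \<in> I \<Longrightarrow> x i \<le> 1"
  shows "1 - exp (- 2 * (\<Sum>i\<in>I. - ln (1 - d * x i))) \<le> 2 * d * (\<Sum>i\<in>I. x i)"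
  using I x
proof (induction I)
  case (insert i I)
  let ?a = "- ln (1 - d * x i)" and ?b = "\<Sum>i\<in>I. - ln (1 - d * x i)"
  have "0 \<le> ?a" "0 \<le> ?b"
    using insert.prems d by (auto intro!: neg_ln_one_minus_nonneg sum_nonneg simp del: neg_0_le_iff_le sum_negf)
  then have "0 \<le> (1 - exp (- 2 * ?a)) * (1 - exp (- 2 * ?b))"
    by (intro mult_nonneg_nonneg) auto
  then have "1 - exp (- 2 * (?a + ?b)) \<le> (1 - exp (- 2 * ?a)) + (1 - exp (- 2 * ?b))"
    by (simp add: algebra_simps exp_add[symmetric])
  also have "\<dots> \<le> 2 * d * x i + 2 * d * (\<Sum>i\<in>I. x i)"
    using insert d by (intro add_mono one_minus_exp_neg_ln_le) auto
  finally show ?case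
    using insert.hyps by (simp add: distrib_left)
qed simp

text \<open>The cross terms \<open>4 * d\<^sup>2 * x i * x k\<close> of
  \<open>outer_defect_add\<close> are the off-diagonal part of the last square; its diagonal part is
  taken off the first coefficient.\<close>

lemma outer_defect_sum_le:
  fixes d :: real and x :: "'i \<Rightarrow> real"
  assumes d: "0 \<le> d" "d < 1" and I: "finite I"
    and x: "\<And>i. i \<in> I \<Longrightarrow> 0 \<le> x i" "\<And>i. i \<in> I \<Longrightarrow> x i \<le> 1"
  shows "outer_defect (\<Sum>i\<in>I. - ln (1 - d * x i))
     \<le> (outer_defect (- ln (1 - d)) - 2 * d\<^sup>2) * (\<Sum>i\<in>I. (x i)\<^sup>2) + 2 * d\<^sup>2 * (\<Sum>i\<in>I. x i)\<^sup>2"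
  using I x
proof (induction I)
  case empty
  show ?case by (simp add: outer_defect_def)
next
  case (insert i I)
  let ?a = "- ln (1 - d * x i)" and ?b = "\<Sum>i\<in>I. - ln (1 - d * x i)"
  have nonneg: "0 \<le> ?a" "0 \<le> ?b"
    using insert.prems d by (auto intro!: neg_ln_one_minus_nonneg sum_nonneg simp del: neg_0_le_iff_le sum_negf)
  have "1 - exp (- 2 * ?a) \<le> 2 * d * x i"
    using insert.prems d by (intro one_minus_exp_neg_ln_le) auto
  moreover have "1 - exp (- 2 * ?b) \<le> 2 * d * (\<Sum>i\<in>I. x i)"
    using insert by (intro one_minus_exp_sum_le d) auto
  ultimately have "(1 - exp (- 2 * ?a)) * (1 - exp (- 2 * ?b)) \<le> (2 * d * x i) * (2 * d * (\<Sum>i\<in>I. x i))"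
    using nonneg insert.prems d by (intro mult_mono) auto
  moreover have "outer_defect ?a \<le> outer_defect (- ln (1 - d)) * (x i)\<^sup>2"
    using insert.prems d by (intro outer_defect_neg_ln_scale) auto
  moreover have "outer_defect ?b \<le> (outer_defect (- ln (1 - d)) - 2 * d\<^sup>2) * (\<Sum>i\<in>I. (x i)\<^sup>2)
      + 2 * d\<^sup>2 * (\<Sum>i\<in>I. x i)\<^sup>2"
    using insert by auto
  ultimately have "outer_defect (?a + ?b) \<le> outer_defect (- ln (1 - d)) * (x i)\<^sup>2
      + ((outer_defect (- ln (1 - d)) - 2 * d\<^sup>2) * (\<Sum>i\<in>I. (x i)\<^sup>2) + 2 * d\<^sup>2 * (\<Sum>i\<in>I. x i)\<^sup>2)
      + (2 * d * x i) * (2 * d * (\<Sum>i\<in>I. x i))"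
    unfolding outer_defect_add by linarith
  also have "\<dots> = (outer_defect (- ln (1 - d)) - 2 * d\<^sup>2) * ((x i)\<^sup>2 + (\<Sum>i\<in>I. (x i)\<^sup>2))
      + 2 * d\<^sup>2 * (x i + (\<Sum>i\<in>I. x i))\<^sup>2"
    by (simp add: power2_eq_square algebra_simps)
  finally show ?case
    using insert.hyps by simp
qed

section \<open>Exponential sums\<close>

definition expsum :: "int set \<Rightarrow> complex \<Rightarrow> complex" where
  "expsum B z = (\<Sum>n\<in>B. z powi n)"

lemma continuous_on_powi_circle [continuous_intros]:
  "continuous_on (sphere 0 1) (\<lambda>z::complex. z powi n)"
  by (intro continuous_intros) auto

lemma continuous_on_expsum [continuous_intros]: "continuous_on (sphere 0 1) (expsum B)"
  unfolding expsum_def by (intro continuous_intros)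

lemma expsum_Un:
  assumes "finite B" "finite C" "B \<inter> C = {}"
  shows "expsum (B \<union> C) z = expsum B z + expsum C z"
  unfolding expsum_def by (rule sum.union_disjoint[OF assms])

lemma cnj_powi_circle:
  assumes "cmod z = 1"
  shows "cnj (z powi n) = z powi (- n)"
proof -
  have "cnj z = inverse z"
    using assms by (simp add: inverse_complex_def complex_eq_iff cmod_def)
  then show ?thesis
    by (simp add: power_int_minus power_int_inverse)
qed

text \<open>The product is entire and vanishes at \<open>0\<close>.\<close>

lemma circle_mean_powi_mult_holomorphic:
  assumes "P holomorphic_on UNIV" "0 < n"
  shows "circle_mean (\<lambda>z. z powi n * P z) = 0"
proof -
  have "circle_mean (\<lambda>z. z ^ nat n * P z) = 0 ^ nat n * P 0"
    by (intro circle_mean_holomorphic holomorphic_intros assms)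
  then show ?thesis
    using assms by (simp add: power_int_def)
qed

lemma circle_mean_powi: "circle_mean (\<lambda>z. z powi n) = (if n = 0 then 1 else 0)"
proof -
  have pos: "circle_mean (\<lambda>z. z powi m) = 0" if "0 < m" for m
    using circle_mean_powi_mult_holomorphic[of "\<lambda>_. 1" m] that by simp
  have "circle_mean (\<lambda>z. z powi n) = 0" if "n < 0"
  proof -
    have "circle_mean (\<lambda>z. z powi n) = circle_mean (\<lambda>z. cnj (z powi (- n)))"
      by (rule circle_mean_cong) (simp add: cnj_powi_circle del: complex_cnj_power_int)
    then show ?thesis
      using pos[of "- n"] that cnj_circle_mean[of "\<lambda>z. z powi (- n)"] by simp
  qed
  then show ?thesis
    using pos[of n] by (cases n "0::int" rule: linorder_cases) auto
qed

text \<open>With \<open>Q = 1\<close> this gives orthogonality; with \<open>Q\<close> entire, every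
  pair with \<open>n < m\<close> contributes nothing.\<close>

lemma circle_mean_cnj_expsum_mult_expsum:
  assumes "finite B" "finite C" "continuous_on (sphere 0 1) Q"
  shows "circle_mean (\<lambda>z. cnj (expsum B z) * expsum C z * Q z)
         = (\<Sum>n\<in>B. \<Sum>m\<in>C. circle_mean (\<lambda>z. z powi (m - n) * Q z))"
proof -
  have "cnj (expsum B z) * expsum C z * Q z = (\<Sum>n\<in>B. \<Sum>m\<in>C. z powi (m - n) * Q z)"
    if "cmod z = 1" for z
  proof -
    have "z \<noteq> 0" using that by auto
    have "cnj (expsum B z) * expsum C z * Q z
        = (\<Sum>n\<in>B. z powi (- n)) * (\<Sum>m\<in>C. z powi m) * Q z"
      using cnj_powi_circle[OF that] by (simp add: expsum_def del: complex_cnj_power_int)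
    also have "\<dots> = (\<Sum>n\<in>B. \<Sum>m\<in>C. z powi (- n) * z powi m * Q z)"
      by (simp only: sum_product) (simp only: sum_distrib_right)
    also have "\<dots> = (\<Sum>n\<in>B. \<Sum>m\<in>C. z powi (m - n) * Q z)"
      using \<open>z \<noteq> 0\<close> by (simp flip: power_int_add)
    finally show ?thesis .
  qed
  then have "circle_mean (\<lambda>z. cnj (expsum B z) * expsum C z * Q z)
      = circle_mean (\<lambda>z. \<Sum>n\<in>B. \<Sum>m\<in>C. z powi (m - n) * Q z)"
    by (rule circle_mean_cong)
  also have "\<dots> = (\<Sum>n\<in>B. \<Sum>m\<in>C. circle_mean (\<lambda>z. z powi (m - n) * Q z))"
    by (subst circle_mean_sum, (intro continuous_intros assms)+)+ simp
  finally show ?thesis .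
qed

lemma circle_mean_cmod_expsum_square:
  assumes "finite B"
  shows "circle_mean (\<lambda>z. (cmod (expsum B z))\<^sup>2) = card B"
proof -
  have "circle_mean (\<lambda>z. cnj (expsum B z) * expsum B z * 1)
      = (\<Sum>n\<in>B. \<Sum>m\<in>B. if m = n then 1 else 0)"
    using assms by (subst circle_mean_cnj_expsum_mult_expsum) (simp_all add: circle_mean_powi)
  also have "\<dots> = of_nat (card B)"
    using assms by simp
  finally have *: "circle_mean (\<lambda>z. cnj (expsum B z) * expsum B z) = of_nat (card B)"
    by simp
  have "circle_mean (\<lambda>z. (cmod (expsum B z))\<^sup>2) = circle_mean (\<lambda>z. Re (cnj (expsum B z) * expsum B z))"
    by (simp add: cmod_power2 flip: power2_eq_square)
  also have "\<dots> = Re (circle_mean (\<lambda>z. cnj (expsum B z) * expsum B z))"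
    by (intro Re_circle_mean[symmetric] continuous_intros)
  finally show ?thesis
    by (simp add: *)
qed

lemma cmod_expsum_le:
  assumes "cmod z = 1"
  shows "cmod (expsum B z) \<le> card B"
  using sum_norm_le[of B "\<lambda>n. z powi n" "\<lambda>_. 1"] assms
  by (simp add: expsum_def norm_power_int)

text \<open>The minus sign in the exponent amounts to a conjugation, which preserves the
  modulus.\<close>

lemma circle_L1_norm_indicator_hat:
  "circle_L1_norm (indicator_hat A) = circle_mean (\<lambda>z. cmod (expsum A z))"
proof -
  have "exp (- (2 * complex_of_real pi * \<i> * of_int n * complex_of_real t))
          = cis (of_int n * - (2 * pi * t))" for n t
    by (simp add: cis_conv_exp mult_ac)
  moreover have "cis (of_int n * - (2 * pi * t)) = cnj (cis (2 * pi * t) powi n)" for n t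
    by (simp add: cis_power_int cis_cnj)
  ultimately have "indicator_hat A t = cnj (expsum A (cis (2 * pi * t)))" for t
    by (simp add: indicator_hat_def expsum_def)
  then show ?thesis
    by (simp add: circle_L1_norm_def circle_mean_def)
qed

lemma geometric_sum_tail_le:
  fixes r :: real
  assumes "0 < r" "r < 1" "j \<le> J"
  shows "(\<Sum>k\<in>{j<..J}. r ^ k) \<le> r ^ j * (r / (1 - r))"
proof -
  have "(1 - r) * (\<Sum>k\<in>{j<..J}. r ^ k) = r ^ Suc j - r ^ Suc J"
    using assms(3)
  proof (induction rule: dec_induct)
    case (step n)
    then have "{j<..Suc n} = insert (Suc n) {j<..n}" by auto
    then show ?case
      using step by (simp add: distrib_left) (simp add: algebra_simps)
  qed simp
  then have "(\<Sum>k\<in>{j<..J}. r ^ k) = (r ^ Suc j - r ^ Suc J) / (1 - r)"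
    using assms by (simp add: field_simps)
  also have "\<dots> \<le> r ^ Suc j / (1 - r)"
    using assms by (intro divide_right_mono) auto
  finally show ?thesis by (simp add: mult.commute)
qed

lemma Re_of_real_mult: "Re (of_real r * w) = r * Re w"
  by simp

section \<open>The test function\<close>

text \<open>The summand \<open>1 / (1000 * 64 ^ J * (real J + 1))\<close> is an approximation error, small enough to be
  negligible against the scale \<open>64 ^ - J\<close> even after summation over all blocks.\<close>

locale littlewood_blocks =
  fixes A :: "int set" and S :: "nat \<Rightarrow> int set" and J :: nat and K :: "nat \<Rightarrow> complex \<Rightarrow> complex"
  assumes finite_A: "finite A"
    and block_subset: "k \<le> J \<Longrightarrow> S k \<subseteq> A"
    and card_block: "k \<le> J \<Longrightarrow> card (S k) = 64 ^ k"
    and block_less: "\<lbrakk>j < k; k \<le> J; n \<in> S j; m \<in> S k\<rbrakk> \<Longrightarrow> n < m"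
    and rest_less: "\<lbrakk>j \<le> J; n \<in> S j; m \<in> A; \<And>k. k \<le> J \<Longrightarrow> m \<notin> S k\<rbrakk> \<Longrightarrow> n < m"
    and K_holomorphic: "K k holomorphic_on UNIV"
    and Im_K_0: "Im (K k 0) = 0"
    and K_ge: "cmod z = 1 \<Longrightarrow> k \<le> J \<Longrightarrow>
      - ln (1 - 15 / 16 * cmod (expsum (S k) z / 64 ^ k)) \<le> Re (K k z)"
    and K_le: "cmod z = 1 \<Longrightarrow> k \<le> J \<Longrightarrow>
      Re (K k z) \<le> - ln (1 - 15 / 16 * cmod (expsum (S k) z / 64 ^ k)) + 1 / (1000 * 64 ^ J * (real J + 1))"
begin

text \<open>The conjugate makes \<open>block_avg k z * expsum (S k) z\<close> equal to the
  nonnegative number \<open>64 ^ k * (block_abs k z)\<^sup>2\<close>.\<close>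

definition block_avg :: "nat \<Rightarrow> complex \<Rightarrow> complex" where
  "block_avg k z = cnj (expsum (S k) z) / 64 ^ k"

definition block_abs :: "nat \<Rightarrow> complex \<Rightarrow> real" where
  "block_abs k z = cmod (block_avg k z)"

definition damping_exponent :: "nat \<Rightarrow> nat \<Rightarrow> complex \<Rightarrow> complex" where
  "damping_exponent j m z = (\<Sum>k\<in>{j<..m}. K k z)"

text \<open>The cutoff \<open>m\<close> allows blocks to be added one at a time; duality uses
  \<open>m = J\<close>.\<close>

definition test_function :: "nat \<Rightarrow> complex \<Rightarrow> complex" where
  "test_function m z = 15 / 16 * (\<Sum>j\<le>m. block_avg j z * exp (- damping_exponent j m z))"

lemma finite_block: "k \<le> J \<Longrightarrow> finite (S k)"
  using finite_A block_subset finite_subset by blast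

lemma block_abs_eq: "block_abs k z = cmod (expsum (S k) z / 64 ^ k)"
  by (simp add: block_abs_def block_avg_def norm_divide)

lemma continuous_on_block_avg [continuous_intros]: "continuous_on (sphere 0 1) (block_avg k)"
  unfolding block_avg_def by (intro continuous_intros) simp

lemma continuous_on_block_abs [continuous_intros]: "continuous_on (sphere 0 1) (block_abs k)"
  unfolding block_abs_def by (intro continuous_intros)

lemma continuous_on_K [continuous_intros]: "continuous_on (sphere 0 1) (K k)"
  using K_holomorphic holomorphic_on_imp_continuous_on continuous_on_subset by blast

lemma continuous_on_damping_exponent [continuous_intros]:
  "continuous_on (sphere 0 1) (damping_exponent j m)"
  unfolding damping_exponent_def by (intro continuous_intros)

lemma damping_exponent_holomorphic [holomorphic_intros]: "damping_exponent j m holomorphic_on UNIV"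
  unfolding damping_exponent_def by (intro holomorphic_intros K_holomorphic)

lemma block_abs_nonneg: "0 \<le> block_abs k z"
  by (simp add: block_abs_def)

lemma block_abs_le_1:
  assumes "cmod z = 1" "k \<le> J"
  shows "block_abs k z \<le> 1"
  using cmod_expsum_le[OF assms(1), of "S k"] card_block[OF assms(2)]
  by (simp add: block_abs_eq norm_divide norm_power)

section \<open>Square means and correlations of the block averages\<close>

lemma circle_mean_block_abs_square:
  assumes "k \<le> J"
  shows "circle_mean (\<lambda>z. (block_abs k z)\<^sup>2) = (1 / 64) ^ k"
proof -
  have "circle_mean (\<lambda>z. (block_abs k z)\<^sup>2)
      = circle_mean (\<lambda>z. (1 / 64 ^ k)\<^sup>2 * (cmod (expsum (S k) z))\<^sup>2)"
    by (simp add: block_abs_eq norm_divide norm_power power_divide)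
  also have "\<dots> = (1 / 64 ^ k)\<^sup>2 * 64 ^ k"
    using assms by (subst circle_mean_mult)
      (simp add: circle_mean_cmod_expsum_square finite_block card_block)
  finally show ?thesis
    by (simp add: power2_eq_square power_divide)
qed

lemma circle_mean_block_abs_mult:
  assumes "j \<le> J" "k \<le> J"
  shows "circle_mean (\<lambda>z. block_abs j z * block_abs k z) \<le> (1 / 8) ^ j * (1 / 8) ^ k"
proof -
  \<comment> \<open>The square norms of the factors are \<open>(1 / 8) ^ j\<close> and
    \<open>(1 / 8) ^ k\<close>; this weight makes both terms of the weighted mean inequality
    equal.\<close>
  define s :: real where "s = 8 ^ j / 8 ^ k"
  have "s > 0" by (simp add: s_def)
  have "circle_mean (\<lambda>z. block_abs j z * block_abs k z)
      \<le> circle_mean (\<lambda>z. s / 2 * (block_abs j z)\<^sup>2 + 1 / (2 * s) * (block_abs k z)\<^sup>2)"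
  proof (rule circle_mean_mono)
    fix z
    have "0 \<le> (s * block_abs j z - block_abs k z)\<^sup>2" by simp
    then show "block_abs j z * block_abs k z
        \<le> s / 2 * (block_abs j z)\<^sup>2 + 1 / (2 * s) * (block_abs k z)\<^sup>2"
      using \<open>s > 0\<close> by (simp add: field_simps power2_eq_square)
  qed (intro continuous_intros)+
  also have "\<dots> = s / 2 * (1 / 64) ^ j + 1 / (2 * s) * (1 / 64) ^ k"
    using assms by (subst circle_mean_add)
      (auto intro!: continuous_intros simp: circle_mean_mult circle_mean_block_abs_square
        simp del: times_divide_eq_left)
  also have "\<dots> = (1 / 8) ^ j * (1 / 8) ^ k"
  proof -
    have "(64::real) ^ i = 8 ^ i * 8 ^ i" for i
      by (simp flip: power_mult_distrib)
    then show ?thesis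
      by (simp add: s_def power_divide field_simps)
  qed
  finally show ?thesis .
qed

text \<open>A new block multiplies the old function by \<open>exp (- K (Suc m) z)\<close>, of
  modulus at most \<open>1 - 15 / 16 * block_abs (Suc m) z\<close> by \<open>K_ge\<close>. This
  leaves exactly the room that the new summand takes.\<close>

lemma cmod_test_function_le:
  assumes "cmod z = 1" "m \<le> J"
  shows "cmod (test_function m z) \<le> 1"
  using assms(2)
proof (induction m)
  case 0
  have "cmod (block_avg 0 z) \<le> 1"
    using block_abs_le_1[OF assms(1), of 0] by (simp add: block_abs_def)
  then show ?case
    by (simp add: test_function_def damping_exponent_def norm_mult)
next
  case (Suc m)
  have "damping_exponent j (Suc m) z = damping_exponent j m z + K (Suc m) z" if "j \<le> m" for j
  proof -
    have "{j<..Suc m} = insert (Suc m) {j<..m}" using that by auto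
    then show ?thesis by (simp add: damping_exponent_def)
  qed
  \<comment> \<open>The new summand is undamped, since its exponent is an empty sum.\<close>
  then have "test_function (Suc m) z =
      15 / 16 * (\<Sum>j\<le>m. block_avg j z * exp (- damping_exponent j m z) * exp (- K (Suc m) z))
      + 15 / 16 * block_avg (Suc m) z"
    by (simp add: test_function_def damping_exponent_def exp_add[symmetric] distrib_left mult.assoc)
  also have "\<dots> = test_function m z * exp (- K (Suc m) z) + 15 / 16 * block_avg (Suc m) z"
    by (simp add: test_function_def sum_distrib_right mult.assoc)
  finally have "cmod (test_function (Suc m) z)
      \<le> cmod (test_function m z) * cmod (exp (- K (Suc m) z)) + 15 / 16 * block_abs (Suc m) z"
    using norm_triangle_ineq[of "test_function m z * exp (- K (Suc m) z)" "15 / 16 * block_avg (Suc m) z"]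
    by (simp add: norm_mult block_abs_def)
  moreover have "cmod (test_function m z) * cmod (exp (- K (Suc m) z)) \<le> 1 * exp (- Re (K (Suc m) z))"
    using Suc by (intro mult_mono) (auto simp: norm_exp_eq_Re)
  moreover have "exp (- Re (K (Suc m) z)) \<le> 1 - 15 / 16 * block_abs (Suc m) z"
  proof -
    have pos: "0 < 1 - 15 / 16 * block_abs (Suc m) z"
      using block_abs_le_1[OF assms(1) Suc.prems] by simp
    have "- Re (K (Suc m) z) \<le> ln (1 - 15 / 16 * block_abs (Suc m) z)"
      using K_ge[OF assms(1) Suc.prems] by (simp add: block_abs_eq)
    then show ?thesis
      using pos by (metis exp_le_cancel_iff exp_ln)
  qed
  ultimately show ?case by linarith
qed

text \<open>At most \<open>J - j\<close> approximation errors add up; the factor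
  \<open>1 / (real J + 1)\<close> absorbs their number.\<close>

lemma Re_damping_exponent_le:
  assumes "cmod z = 1" "j \<le> J"
  shows "(\<Sum>k\<in>{j<..J}. - ln (1 - 15 / 16 * block_abs k z)) \<le> Re (damping_exponent j J z)"
    and "Re (damping_exponent j J z)
      \<le> (\<Sum>k\<in>{j<..J}. - ln (1 - 15 / 16 * block_abs k z)) + (1 / 64) ^ j / 1000"
proof -
  show "(\<Sum>k\<in>{j<..J}. - ln (1 - 15 / 16 * block_abs k z)) \<le> Re (damping_exponent j J z)"
    unfolding damping_exponent_def Re_sum block_abs_eq
    using assms by (intro sum_mono K_ge) auto
  have "Re (damping_exponent j J z)
      \<le> (\<Sum>k\<in>{j<..J}. - ln (1 - 15 / 16 * block_abs k z) + 1 / (1000 * 64 ^ J * (real J + 1)))"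
    unfolding damping_exponent_def Re_sum block_abs_eq
    using assms by (intro sum_mono K_le) auto
  also have "\<dots> = (\<Sum>k\<in>{j<..J}. - ln (1 - 15 / 16 * block_abs k z))
      + real (J - j) / (real J + 1) * (1 / (1000 * 64 ^ J))"
    unfolding sum.distrib by simp
  also have "real (J - j) / (real J + 1) * (1 / (1000 * 64 ^ J)) \<le> 1 * (1 / (1000 * 64 ^ j))"
    using assms by (intro mult_mono frac_le mult_left_mono power_increasing) auto
  finally show "Re (damping_exponent j J z)
      \<le> (\<Sum>k\<in>{j<..J}. - ln (1 - 15 / 16 * block_abs k z)) + (1 / 64) ^ j / 1000"
    by (simp add: power_divide)
qed


section \<open>Mean estimates for the damping factors\<close>

text \<open>The outer defect of the exponent is bounded by a diagonal sum and a double sum over the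
  later blocks. Their means are geometric tails, both of order \<open>(1 / 64) ^ j\<close>.\<close>

lemma circle_mean_one_minus_damping:
  assumes "j \<le> J"
  shows "64 ^ j * circle_mean (\<lambda>z. (cmod (1 - exp (- damping_exponent j J z)))\<^sup>2) \<le> 83 / 1000"
proof -
  \<comment> \<open>The diagonal coefficient of \<open>outer_defect_sum_le\<close>. As
    \<open>1 - 15 / 16\<close> is a power of \<open>2\<close>, bounds for \<open>ln 2\<close>
    suffice to estimate it.\<close>
  define \<Phi> where "\<Phi> = outer_defect (- ln (1 - 15 / 16)) - 2 * (15 / 16)\<^sup>2"
  have "ln (1 - 15 / 16 :: real) = - (4 * ln 2)"
    using ln_div[of 1 "2 ^ 4 :: real"] ln_realpow[of "2::real" 4] by simp
  then have "\<Phi> = (15 / 16)\<^sup>2 + 2 * (4 * ln 2 - 15 / 16) - 2 * (15 / 16)\<^sup>2"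
    unfolding \<Phi>_def by (subst outer_defect_neg_ln) auto
  then have \<Phi>: "0 \<le> \<Phi>" "\<Phi> \<le> 2.802"
    using ln2_ge_two_thirds ln2_le_25_over_36 by (auto simp: power2_eq_square)
  have "circle_mean (\<lambda>z. (cmod (1 - exp (- damping_exponent j J z)))\<^sup>2)
      \<le> circle_mean (\<lambda>z. outer_defect (Re (damping_exponent j J z)))"
    by (intro circle_mean_one_minus_exp holomorphic_intros)
       (simp add: damping_exponent_def Im_K_0)
  \<comment> \<open>The square is written as a double sum to allow termwise means. The
    \<open>1 / 500\<close> is twice the error \<open>1 / 1000\<close> of the exponent.\<close>
  also have "\<dots> \<le> circle_mean (\<lambda>z. (\<Phi> * (\<Sum>k\<in>{j<..J}. (block_abs k z)\<^sup>2)
      + 2 * (15 / 16)\<^sup>2 * (\<Sum>k\<in>{j<..J}. \<Sum>l\<in>{j<..J}. block_abs k z * block_abs l z))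
      + (1 / 64) ^ j / 500)"
  proof (rule circle_mean_mono)
    fix z :: complex
    assume z: "cmod z = 1"
    let ?u = "\<Sum>k\<in>{j<..J}. - ln (1 - 15 / 16 * block_abs k z)"
    let ?q = "Re (damping_exponent j J z)"
    have h1: "outer_defect ?q \<le> outer_defect ?u + 2 * (?q - ?u)"
      using outer_defect_add_le[of "?q - ?u" ?u] Re_damping_exponent_le[OF z assms] by simp
    have h2: "?q - ?u \<le> (1 / 64) ^ j / 1000"
      using Re_damping_exponent_le[OF z assms] by linarith
    have h3: "outer_defect ?u \<le> \<Phi> * (\<Sum>k\<in>{j<..J}. (block_abs k z)\<^sup>2)
        + 2 * (15 / 16)\<^sup>2 * (\<Sum>k\<in>{j<..J}. block_abs k z)\<^sup>2"
      unfolding \<Phi>_def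
      by (intro outer_defect_sum_le) (use block_abs_nonneg block_abs_le_1[OF z] in auto)
    show "outer_defect ?q \<le> (\<Phi> * (\<Sum>k\<in>{j<..J}. (block_abs k z)\<^sup>2)
      + 2 * (15 / 16)\<^sup>2 * (\<Sum>k\<in>{j<..J}. \<Sum>l\<in>{j<..J}. block_abs k z * block_abs l z))
      + (1 / 64) ^ j / 500"
      using order_trans[OF h1 add_mono[OF h3 mult_left_mono[OF h2, of 2]]]
      unfolding power2_eq_square[of "sum _ _"] sum_product by simp
  qed ((unfold outer_defect_def)?, intro continuous_intros)+
  also have "\<dots> = (\<Phi> * (\<Sum>k\<in>{j<..J}. circle_mean (\<lambda>z. (block_abs k z)\<^sup>2))
      + 2 * (15 / 16)\<^sup>2 * (\<Sum>k\<in>{j<..J}. \<Sum>l\<in>{j<..J}. circle_mean (\<lambda>z. block_abs k z * block_abs l z)))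
      + (1 / 64) ^ j / 500"
    by ((subst circle_mean_add, (intro continuous_intros)+)+, simp only: circle_mean_mult circle_mean_const,
        (subst circle_mean_sum, rule finite_greaterThanAtMost, intro continuous_intros)+, (rule refl)?)
  also have "\<dots> \<le> (\<Phi> * (\<Sum>k\<in>{j<..J}. (1 / 64) ^ k)
      + 2 * (15 / 16)\<^sup>2 * (\<Sum>k\<in>{j<..J}. \<Sum>l\<in>{j<..J}. (1 / 8) ^ k * (1 / 8) ^ l))
      + (1 / 64) ^ j / 500"
    using \<Phi> by (intro add_mono mult_left_mono sum_mono)
      (auto simp: circle_mean_block_abs_square intro!: circle_mean_block_abs_mult)
  also have "\<dots> = \<Phi> * (\<Sum>k\<in>{j<..J}. (1 / 64) ^ k)
      + 2 * (15 / 16)\<^sup>2 * (\<Sum>k\<in>{j<..J}. (1 / 8) ^ k)\<^sup>2 + (1 / 64) ^ j / 500"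
    by (simp only: power2_eq_square[of "sum _ _"] sum_product)
  also have "\<dots> \<le> 2.802 * ((1 / 64) ^ j * ((1 / 64) / (1 - 1 / 64)))
      + 2 * (15 / 16)\<^sup>2 * ((1 / 8) ^ j * ((1 / 8) / (1 - 1 / 8)))\<^sup>2 + (1 / 64) ^ j / 500"
    using \<Phi> assms
    by (intro add_mono mult_mono mult_left_mono power_mono geometric_sum_tail_le sum_nonneg) auto
  \<comment> \<open>The tails of ratio \<open>1 / 64\<close> and \<open>1 / 8\<close> give
    \<open>1 / 63\<close> and, squared, \<open>1 / 49\<close>. The bracket is about
    \<open>0.0824\<close>.\<close>
  also have "\<dots> = (2.802 / 63 + 2 * (15 / 16)\<^sup>2 / 49 + 1 / 500) * (1 / 64) ^ j"
  proof -
    define x :: real where "x = (1 / 8) ^ j"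
    have "(1 / 64) ^ j = x\<^sup>2"
      by (simp add: x_def power2_eq_square flip: power_mult_distrib)
    then show ?thesis
      unfolding x_def[symmetric] by (simp add: power2_eq_square algebra_simps)
  qed
  also have "\<dots> \<le> 83 / 1000 * (1 / 64) ^ j"
    by (intro mult_right_mono) (auto simp: power2_eq_square)
  finally show ?thesis
    by (simp add: power_divide field_simps)
qed

text \<open>The loss \<open>1 - (cmod P)\<^sup>2\<close> is at most linear in the later block
  averages, so only correlations of two blocks remain; their tail gives
  \<open>15 / 8 * (1 / 7) = 15 / 56\<close>.\<close>

lemma circle_mean_block_abs_damping:
  assumes "j \<le> J"
  shows "64 ^ j * circle_mean (\<lambda>z. (block_abs j z)\<^sup>2 * (1 - (cmod (exp (- damping_exponent j J z)))\<^sup>2))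
    \<le> 27 / 100"
proof -
  have "circle_mean (\<lambda>z. (block_abs j z)\<^sup>2 * (1 - (cmod (exp (- damping_exponent j J z)))\<^sup>2))
      \<le> circle_mean (\<lambda>z. 15 / 8 * (\<Sum>k\<in>{j<..J}. block_abs j z * block_abs k z) + (1 / 64) ^ j / 500 * (block_abs j z)\<^sup>2)"
  proof (rule circle_mean_mono)
    fix z :: complex
    assume z: "cmod z = 1"
    let ?u = "\<Sum>k\<in>{j<..J}. - ln (1 - 15 / 16 * block_abs k z)"
    let ?q = "Re (damping_exponent j J z)"
    have "1 - (cmod (exp (- damping_exponent j J z)))\<^sup>2 = 1 - exp (- 2 * ?q)"
      by (simp add: norm_exp_eq_Re flip: exp_double)
    \<comment> \<open>Separates the exact logarithms \<open>?u\<close> from the approximation error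
      \<open>?q - ?u\<close>.\<close>
    also have "\<dots> \<le> (1 - exp (- 2 * ?u)) + 2 * (?q - ?u)"
    proof -
      have u: "0 \<le> ?u"
        using block_abs_nonneg block_abs_le_1[OF z]
        by (intro sum_nonneg neg_ln_one_minus_nonneg) auto
      have "1 - exp (- 2 * (?q - ?u)) \<le> 2 * (?q - ?u)"
        using exp_ge_add_one_self[of "- 2 * (?q - ?u)"] by linarith
      moreover have "exp (- 2 * ?u) \<le> 1"
        using u by (subst exp_le_one_iff) linarith
      moreover have "0 \<le> 1 - exp (- 2 * (?q - ?u))"
        using Re_damping_exponent_le(1)[OF z assms] by simp
      ultimately have "exp (- 2 * ?u) * (1 - exp (- 2 * (?q - ?u))) \<le> 1 * (2 * (?q - ?u))"
        by (intro mult_mono) simp_all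
      then show ?thesis
        by (simp add: algebra_simps flip: exp_add)
    qed
    also have "\<dots> \<le> 2 * (15 / 16) * (\<Sum>k\<in>{j<..J}. block_abs k z) + 2 * ((1 / 64) ^ j / 1000)"
      using Re_damping_exponent_le(2)[OF z assms] block_abs_nonneg block_abs_le_1[OF z]
      by (intro add_mono one_minus_exp_sum_le) auto
    finally have *: "1 - (cmod (exp (- damping_exponent j J z)))\<^sup>2
        \<le> 15 / 8 * (\<Sum>k\<in>{j<..J}. block_abs k z) + (1 / 64) ^ j / 500"
      by simp
    have "(block_abs j z)\<^sup>2 * (1 - (cmod (exp (- damping_exponent j J z)))\<^sup>2)
        \<le> (block_abs j z)\<^sup>2 * (15 / 8 * (\<Sum>k\<in>{j<..J}. block_abs k z)) + (block_abs j z)\<^sup>2 * ((1 / 64) ^ j / 500)"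
      using mult_left_mono[OF *, of "(block_abs j z)\<^sup>2"] by (simp add: distrib_left)
    \<comment> \<open>One factor \<open>block_abs j z\<close> is bounded by \<open>1\<close>,
      leaving products of two block averages.\<close>
    also have "(block_abs j z)\<^sup>2 * (15 / 8 * (\<Sum>k\<in>{j<..J}. block_abs k z))
        \<le> block_abs j z * (15 / 8 * (\<Sum>k\<in>{j<..J}. block_abs k z))"
      using block_abs_nonneg block_abs_le_1[OF z assms]
      by (intro mult_right_mono) (auto simp: power2_eq_square intro!: mult_left_le sum_nonneg)
    finally show "(block_abs j z)\<^sup>2 * (1 - (cmod (exp (- damping_exponent j J z)))\<^sup>2)
        \<le> 15 / 8 * (\<Sum>k\<in>{j<..J}. block_abs j z * block_abs k z) + (1 / 64) ^ j / 500 * (block_abs j z)\<^sup>2"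
      by (simp add: sum_distrib_left sum_divide_distrib mult_ac)
  qed (intro continuous_intros)+
  also have "\<dots> = 15 / 8 * (\<Sum>k\<in>{j<..J}. circle_mean (\<lambda>z. block_abs j z * block_abs k z))
      + (1 / 64) ^ j / 500 * circle_mean (\<lambda>z. (block_abs j z)\<^sup>2)"
    by ((subst circle_mean_add, (intro continuous_intros)+)+, simp only: circle_mean_mult circle_mean_const,
        (subst circle_mean_sum, rule finite_greaterThanAtMost, intro continuous_intros)+, (rule refl)?)
  also have "\<dots> \<le> 15 / 8 * (\<Sum>k\<in>{j<..J}. (1 / 8) ^ j * (1 / 8) ^ k) + 1 / 500 * (1 / 64) ^ j"
  proof (intro add_mono mult_left_mono sum_mono)
    show "(1 / 64) ^ j / 500 * circle_mean (\<lambda>z. (block_abs j z)\<^sup>2) \<le> 1 / 500 * (1 / 64) ^ j"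
      using assms power_le_one[of "1 / 64 :: real" j]
      by (simp add: circle_mean_block_abs_square mult_left_le)
  qed (use assms in \<open>auto intro!: circle_mean_block_abs_mult\<close>)
  also have "\<dots> = 15 / 8 * ((1 / 8) ^ j * (\<Sum>k\<in>{j<..J}. (1 / 8) ^ k)) + 1 / 500 * (1 / 64) ^ j"
    by (simp add: sum_distrib_left)
  also have "\<dots> \<le> 15 / 8 * ((1 / 8) ^ j * ((1 / 8) ^ j * ((1 / 8) / (1 - 1 / 8)))) + 1 / 500 * (1 / 64) ^ j"
    using assms by (intro add_mono mult_left_mono geometric_sum_tail_le) auto
  also have "\<dots> = (15 / 56 + 1 / 500) * (1 / 64) ^ j"
  proof -
    have "(1 / 8 :: real) ^ j * (1 / 8) ^ j = (1 / 64) ^ j"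
      by (simp flip: power_mult_distrib)
    then show ?thesis
      by (simp add: algebra_simps flip: mult.assoc)
  qed
  also have "\<dots> \<le> 27 / 100 * (1 / 64) ^ j"
    by (intro mult_right_mono) auto
  finally show ?thesis
    by (simp add: power_divide field_simps)
qed


text \<open>Elements above the block drop out by holomorphy. Below it, orthogonality allows
  \<open>P\<close> to be replaced by \<open>P - 1\<close>. The block itself gives the main term
  \<open>1\<close>, up to the two preceding estimates.\<close>

lemma Re_circle_mean_block_ge:
  assumes "j \<le> J"
  shows "78 / 100 \<le> Re (circle_mean (\<lambda>z. block_avg j z * exp (- damping_exponent j J z) * expsum A z))"
proof -
  define P where "P z = exp (- damping_exponent j J z)" for z
  define B where "B = (\<Union>i<j. S i)"
  \<comment> \<open>Besides the later blocks this contains the elements in no block, which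
    \<open>rest_less\<close> also places above \<open>S j\<close>.\<close>
  define C where "C = A - B - S j"
  have P: "P holomorphic_on UNIV"
    unfolding P_def by (intro holomorphic_intros)
  have contP [continuous_intros]: "continuous_on (sphere 0 1) P"
    unfolding P_def by (intro continuous_intros)
  have fin: "finite B" "finite C" "finite (S j)"
    using assms finite_A by (auto simp: B_def C_def finite_block)
  have "B \<inter> S j = {}"
    using block_less[OF _ assms] by (fastforce simp: B_def)
  then have "expsum (B \<union> S j \<union> C) z = expsum B z + expsum (S j) z + expsum C z" for z
    using fin by (subst expsum_Un; (subst expsum_Un)?; auto simp: C_def)
  moreover have "A = B \<union> S j \<union> C"
    using block_subset[OF assms] block_subset[OF less_imp_le[OF less_le_trans[OF _ assms]]]
    by (auto simp: B_def C_def)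
  ultimately have split: "expsum A z = expsum B z + expsum (S j) z + expsum C z" for z
    by metis
  have C_gt: "n < m" if "n \<in> S j" "m \<in> C" for n m
  proof (cases "\<exists>k\<le>J. m \<in> S k")
    case True
    then obtain k where "k \<le> J" "m \<in> S k" by blast
    moreover from this have "j < k"
      using that by (cases k j rule: linorder_cases) (auto simp: B_def C_def)
    ultimately show ?thesis
      using block_less that by blast
  next
    case False
    then show ?thesis
      using rest_less[OF assms] that by (auto simp: C_def)
  qed
  have zero_C: "circle_mean (\<lambda>z. cnj (expsum (S j) z) * expsum C z * P z) = 0"
    using C_gt by (auto simp: circle_mean_cnj_expsum_mult_expsum fin contP
        circle_mean_powi_mult_holomorphic[OF P] intro!: sum.neutral)
  have zero_B: "circle_mean (\<lambda>z. cnj (expsum (S j) z) * expsum B z * 1) = 0"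
    using \<open>B \<inter> S j = {}\<close>
    by (subst circle_mean_cnj_expsum_mult_expsum) (auto simp: fin circle_mean_powi intro!: sum.neutral)
  let ?M = "circle_mean (\<lambda>z. 64 ^ j * of_real ((block_abs j z)\<^sup>2) * P z)"
  let ?R = "circle_mean (\<lambda>z. block_avg j z * expsum B z * (1 - P z))"
  have "block_avg j z * P z * expsum A z
      = (64 ^ j * of_real ((block_abs j z)\<^sup>2) * P z - block_avg j z * expsum B z * (1 - P z))
        + (1 / 64 ^ j * (cnj (expsum (S j) z) * expsum B z * 1)
        + 1 / 64 ^ j * (cnj (expsum (S j) z) * expsum C z * P z))" for z
  proof -
    have "64 ^ j * of_real ((block_abs j z)\<^sup>2) = block_avg j z * expsum (S j) z"
      unfolding block_abs_def complex_norm_square by (simp add: block_avg_def)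
    moreover have "1 / 64 ^ j * (cnj (expsum (S j) z) * v * w) = block_avg j z * v * w" for v w
      by (simp add: block_avg_def)
    ultimately show ?thesis
      unfolding split by (simp only:) (simp add: algebra_simps)
  qed
  then have "circle_mean (\<lambda>z. block_avg j z * P z * expsum A z)
      = circle_mean (\<lambda>z. (64 ^ j * of_real ((block_abs j z)\<^sup>2) * P z - block_avg j z * expsum B z * (1 - P z))
        + (1 / 64 ^ j * (cnj (expsum (S j) z) * expsum B z * 1)
        + 1 / 64 ^ j * (cnj (expsum (S j) z) * expsum C z * P z)))"
    by (intro circle_mean_cong)
  also have "\<dots> = (?M - ?R)
      + (1 / 64 ^ j * circle_mean (\<lambda>z. cnj (expsum (S j) z) * expsum B z * 1)
        + 1 / 64 ^ j * circle_mean (\<lambda>z. cnj (expsum (S j) z) * expsum C z * P z))"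
    by ((subst circle_mean_add, (intro continuous_intros)+)+, subst circle_mean_diff,
        (intro continuous_intros)+, simp only: circle_mean_mult)
  finally have eq: "circle_mean (\<lambda>z. block_avg j z * P z * expsum A z) = ?M - ?R"
    unfolding zero_B zero_C by simp
  define D where "D = circle_mean (\<lambda>z. (cmod (1 - P z))\<^sup>2)"
  define E where "E = circle_mean (\<lambda>z. (block_abs j z)\<^sup>2 * (1 - (cmod (P z))\<^sup>2))"
  have "64 ^ j * ((1 / 64) ^ j - 1 / 2 * D - 1 / 2 * E)
      = circle_mean (\<lambda>z. 64 ^ j * ((block_abs j z)\<^sup>2 - 1 / 2 * (cmod (1 - P z))\<^sup>2
          - 1 / 2 * ((block_abs j z)\<^sup>2 * (1 - (cmod (P z))\<^sup>2))))"
    unfolding circle_mean_block_abs_square[OF assms, symmetric] D_def E_def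
    by (subst circle_mean_diff circle_mean_mult; (intro continuous_intros)?)+ simp
  also have "\<dots> \<le> circle_mean (\<lambda>z. Re (64 ^ j * of_real ((block_abs j z)\<^sup>2) * P z))"
  proof (rule circle_mean_mono)
    fix z :: complex
    assume z: "cmod z = 1"
    have "(cmod (1 - P z))\<^sup>2 = 1 - 2 * Re (P z) + (cmod (P z))\<^sup>2"
      unfolding cmod_power2 by (simp add: power2_eq_square algebra_simps)
    then have Re_P: "Re (P z) = (1 + (cmod (P z))\<^sup>2 - (cmod (1 - P z))\<^sup>2) / 2"
      by simp
    have "(block_abs j z)\<^sup>2 * Re (P z) = (block_abs j z)\<^sup>2
        - 1 / 2 * ((block_abs j z)\<^sup>2 * (cmod (1 - P z))\<^sup>2)
        - 1 / 2 * ((block_abs j z)\<^sup>2 * (1 - (cmod (P z))\<^sup>2))"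
      unfolding Re_P by (simp add: field_simps)
    \<comment> \<open>The weight is dropped here, as the mean of
      \<open>(cmod (1 - P z))\<^sup>2\<close> is already of order
      \<open>(1 / 64) ^ j\<close>.\<close>
    moreover have "(block_abs j z)\<^sup>2 * (cmod (1 - P z))\<^sup>2 \<le> (cmod (1 - P z))\<^sup>2"
      using block_abs_nonneg block_abs_le_1[OF z assms]
      by (intro mult_left_le_one_le) (auto intro: power_le_one)
    ultimately have "64 ^ j * ((block_abs j z)\<^sup>2 - 1 / 2 * (cmod (1 - P z))\<^sup>2
          - 1 / 2 * ((block_abs j z)\<^sup>2 * (1 - (cmod (P z))\<^sup>2))) \<le> 64 ^ j * ((block_abs j z)\<^sup>2 * Re (P z))"
      by (intro mult_left_mono) (linarith, simp)
    also have "\<dots> = Re (of_real (64 ^ j * (block_abs j z)\<^sup>2) * P z)"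
      by (simp only: mult.assoc Re_of_real_mult)
    finally show "64 ^ j * ((block_abs j z)\<^sup>2 - 1 / 2 * (cmod (1 - P z))\<^sup>2
          - 1 / 2 * ((block_abs j z)\<^sup>2 * (1 - (cmod (P z))\<^sup>2)))
        \<le> Re (64 ^ j * of_real ((block_abs j z)\<^sup>2) * P z)"
      by simp
  qed (intro continuous_intros)+
  also have "\<dots> = Re ?M"
    by (intro Re_circle_mean[symmetric] continuous_intros)
  finally have "1 - 1 / 2 * (64 ^ j * D) - 1 / 2 * (64 ^ j * E) \<le> Re ?M"
    by (simp add: algebra_simps power_divide)
  moreover have "Re ?R \<le> 1 / 4 * (64 ^ j * D) + 1 / 63"
  proof -
    have "Re ?R \<le> circle_mean (\<lambda>z. cmod (block_avg j z * expsum B z * (1 - P z)))"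
      by (rule order_trans[OF complex_Re_le_cmod norm_circle_mean_le]) (intro continuous_intros)
    \<comment> \<open>The weight \<open>64 ^ j\<close> makes both terms bounded independently of
      \<open>j\<close>.\<close>
    also have "\<dots> \<le> circle_mean (\<lambda>z. 64 ^ j / 4 * (cmod (1 - P z))\<^sup>2 + (1 / 64) ^ j * (cmod (expsum B z))\<^sup>2)"
    proof (rule circle_mean_mono)
      fix z :: complex
      assume z: "cmod z = 1"
      define s :: real where "s = 64 ^ j"
      have "s > 0" by (simp add: s_def)
      have "cmod (block_avg j z * expsum B z * (1 - P z)) \<le> 1 * (cmod (expsum B z) * cmod (1 - P z))"
        unfolding norm_mult mult.assoc
        using block_abs_le_1[OF z assms] by (intro mult_right_mono) (auto simp: block_abs_def)
      also have "\<dots> \<le> s / 4 * (cmod (1 - P z))\<^sup>2 + 1 / s * (cmod (expsum B z))\<^sup>2"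
      proof -
        have "0 \<le> (s / 2 * cmod (1 - P z) - cmod (expsum B z))\<^sup>2" by simp
        then show ?thesis
          using \<open>s > 0\<close> by (simp add: field_simps power2_eq_square)
      qed
      finally show "cmod (block_avg j z * expsum B z * (1 - P z))
          \<le> 64 ^ j / 4 * (cmod (1 - P z))\<^sup>2 + (1 / 64) ^ j * (cmod (expsum B z))\<^sup>2"
        by (simp add: s_def power_divide)
    qed (intro continuous_intros)+
    also have "\<dots> = 64 ^ j / 4 * D + (1 / 64) ^ j * card B"
      unfolding D_def circle_mean_cmod_expsum_square[OF fin(1), symmetric]
      by (subst circle_mean_add circle_mean_mult; (intro continuous_intros)?)+ simp
    also have "\<dots> \<le> 64 ^ j / 4 * D + (1 / 64) ^ j * (64 ^ j / 63)"
    proof -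
      have "card B \<le> (\<Sum>i<j. card (S i))"
        unfolding B_def by (rule card_UN_le) simp
      also have "\<dots> = (\<Sum>i<j. 64 ^ i)"
        using assms by (intro sum.cong) (auto simp: card_block)
      finally have "real (card B) \<le> real (\<Sum>i<j. 64 ^ i)"
        by (rule of_nat_mono)
      also have "\<dots> \<le> 64 ^ j / 63"
        by (simp add: geometric_sum)
      finally show ?thesis
        by (intro add_mono mult_left_mono) auto
    qed
    finally show ?thesis
      by (simp add: power_divide)
  qed
  moreover have "64 ^ j * D \<le> 83 / 1000" "64 ^ j * E \<le> 27 / 100"
    unfolding D_def E_def P_def
    by (rule circle_mean_one_minus_damping[OF assms] circle_mean_block_abs_damping[OF assms])+
  \<comment> \<open>Numerically
    \<open>1 - 3 / 4 * 0.083 - 1 / 2 * 0.27 - 1 / 63 > 0.786\<close>.\<close>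
  ultimately have "78 / 100 \<le> Re (?M - ?R)"
    by simp
  then have "78 / 100 \<le> Re (circle_mean (\<lambda>z. block_avg j z * P z * expsum A z))"
    unfolding eq .
  then show ?thesis
    unfolding P_def .
qed

text \<open>Duality: the test function has modulus at most \<open>1\<close>, and each of the
  \<open>J + 1\<close> blocks contributes to its pairing with \<open>expsum A\<close>.\<close>

lemma circle_mean_cmod_expsum_ge:
  "15 / 16 * (78 / 100) * (real J + 1) \<le> circle_mean (\<lambda>z. cmod (expsum A z))"
proof -
  have "15 / 16 * (78 / 100) * (real J + 1) = 15 / 16 * (\<Sum>j\<le>J. 78 / 100)"
    by simp
  also have "\<dots> \<le> 15 / 16 * (\<Sum>j\<le>J. Re (circle_mean
      (\<lambda>z. block_avg j z * exp (- damping_exponent j J z) * expsum A z)))"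
    by (intro mult_left_mono sum_mono Re_circle_mean_block_ge) auto
  also have "\<dots> = Re (of_real (15 / 16) * (\<Sum>j\<le>J. circle_mean
      (\<lambda>z. block_avg j z * exp (- damping_exponent j J z) * expsum A z)))"
    unfolding Re_of_real_mult Re_sum ..
  also have "\<dots> = Re (circle_mean (\<lambda>z. test_function J z * expsum A z))"
  proof -
    have "test_function J z * expsum A z = of_real (15 / 16) *
        (\<Sum>j\<le>J. block_avg j z * exp (- damping_exponent j J z) * expsum A z)" for z
      by (simp add: test_function_def sum_distrib_right mult.assoc)
    then have "circle_mean (\<lambda>z. test_function J z * expsum A z) = circle_mean (\<lambda>z. of_real (15 / 16) *
        (\<Sum>j\<le>J. block_avg j z * exp (- damping_exponent j J z) * expsum A z))"
      by (intro circle_mean_cong)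
    also have "\<dots> = of_real (15 / 16) * (\<Sum>j\<le>J. circle_mean
        (\<lambda>z. block_avg j z * exp (- damping_exponent j J z) * expsum A z))"
      by (simp only: circle_mean_mult) (subst circle_mean_sum; (intro continuous_intros)?; simp)
    finally show ?thesis by (simp only:)
  qed
  also have "\<dots> \<le> circle_mean (\<lambda>z. cmod (test_function J z * expsum A z))"
    unfolding test_function_def
    by (rule order_trans[OF complex_Re_le_cmod norm_circle_mean_le]) (intro continuous_intros)
  also have "\<dots> \<le> circle_mean (\<lambda>z. cmod (expsum A z))"
  proof (rule circle_mean_mono)
    show "continuous_on (sphere 0 1) (\<lambda>z. cmod (test_function J z * expsum A z))"
      unfolding test_function_def by (intro continuous_intros)
    show "cmod (test_function J z * expsum A z) \<le> cmod (expsum A z)" if "cmod z = 1" for z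
      using cmod_test_function_le[OF that] by (simp add: norm_mult mult_left_le_one_le)
  qed (intro continuous_intros)
  finally show ?thesis .
qed

end

section \<open>Choice of the blocks and the final count\<close>

text \<open>The increasing enumeration is cut at the partial sums of \<open>len\<close>; what
  remains is its tail.\<close>

lemma obtain_blocks:
  fixes A :: "'a::linorder set" and len :: "nat \<Rightarrow> nat"
  assumes "finite A" "(\<Sum>k\<le>J. len k) \<le> card A"
  obtains S where "\<And>k. k \<le> J \<Longrightarrow> S k \<subseteq> A" "\<And>k. k \<le> J \<Longrightarrow> card (S k) = len k"
    "\<And>j k n m. \<lbrakk>j < k; k \<le> J; n \<in> S j; m \<in> S k\<rbrakk> \<Longrightarrow> n < m"
    "\<And>j n m. \<lbrakk>j \<le> J; n \<in> S j; m \<in> A; \<And>k. k \<le> J \<Longrightarrow> m \<notin> S k\<rbrakk> \<Longrightarrow> n < m"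
proof -
  define a where "a = sorted_list_of_set A"
  define start where "start k = (\<Sum>i<k. len i)" for k
  define S where "S k = (!) a ` {start k..<start (Suc k)}" for k
  have a: "sorted_wrt (<) a" "length a = card A" "set a = A"
    using assms(1) by (auto simp: a_def)
  have nth_less: "a ! p < a ! q" if "p < q" "q < card A" for p q
    using a that by (simp add: sorted_wrt_iff_nth_less)
  have start_mono: "start j \<le> start k" if "j \<le> k" for j k
    unfolding start_def using that by (intro sum_mono2) auto
  have start_le: "start (Suc k) \<le> card A" if "k \<le> J" for k
    using start_mono[of "Suc k" "Suc J"] that assms(2) by (simp add: start_def lessThan_Suc_atMost)
  show thesis
  proof
    fix k assume k: "k \<le> J"
    have lt: "p < card A" if "p \<in> {start k..<start (Suc k)}" for p
      using that start_le[OF k] by simp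
    then show "S k \<subseteq> A"
      unfolding S_def using a by (metis image_subsetI nth_mem)
    have "inj_on ((!) a) {start k..<start (Suc k)}"
      using lt nth_less by (intro linorder_inj_onI) (auto simp: less_imp_neq)
    then show "card (S k) = len k"
      by (simp add: S_def card_image start_def)
  next
    fix j k n m assume "j < k" "k \<le> J" "n \<in> S j" "m \<in> S k"
    then show "n < m"
      using start_mono[of "Suc j" k] start_le[of k] by (auto simp: S_def intro!: nth_less)
  next
    fix j n m assume j: "j \<le> J" "n \<in> S j" and m: "m \<in> A" "\<And>k. k \<le> J \<Longrightarrow> m \<notin> S k"
    obtain q where q: "q < card A" "m = a ! q"
      using m(1) a by (metis in_set_conv_nth)
    \<comment> \<open>The intervals are adjacent and begin at \<open>0\<close>, so an index outside
      all of them lies beyond the last.\<close>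
    have "start (Suc k) \<le> q" if "k \<le> J" for k
      using that
    proof (induction k)
      case 0
      have "q \<notin> {start 0..<start (Suc 0)}"
        using m(2)[OF 0] q by (auto simp: S_def)
      then show ?case by (simp add: start_def)
    next
      case (Suc k)
      then have "q \<notin> {start (Suc k)..<start (Suc (Suc k))}"
        using m(2)[OF Suc.prems] q by (auto simp: S_def)
      then show ?case using Suc by auto
    qed
    from this[OF j(1)] show "n < m"
      using j q by (auto simp: S_def intro!: nth_less)
  qed
qed

lemma circle_L1_norm_ge_blocks:
  assumes "finite A" "64 ^ Suc J \<le> card A"
  shows "15 / 16 * (78 / 100) * (real J + 1) \<le> circle_L1_norm (indicator_hat A)"
proof -
  have "(\<Sum>k\<le>J. 64 ^ k :: nat) \<le> 64 ^ Suc J"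
    by (induction J) auto
  then have "(\<Sum>k\<le>J. 64 ^ k) \<le> card A"
    using assms(2) by linarith
  with assms(1) show ?thesis
  proof (rule obtain_blocks)
    fix S :: "nat \<Rightarrow> int set"
    assume S: "\<And>k. k \<le> J \<Longrightarrow> S k \<subseteq> A" "\<And>k. k \<le> J \<Longrightarrow> card (S k) = 64 ^ k"
      "\<And>j k n m. \<lbrakk>j < k; k \<le> J; n \<in> S j; m \<in> S k\<rbrakk> \<Longrightarrow> n < m"
      "\<And>j n m. \<lbrakk>j \<le> J; n \<in> S j; m \<in> A; \<And>k. k \<le> J \<Longrightarrow> m \<notin> S k\<rbrakk> \<Longrightarrow> n < m"
    \<comment> \<open>Stated for every \<open>k\<close>, with the zero function beyond
      \<open>J\<close>, because the locale asks for holomorphy at all indices.\<close>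
    have "\<exists>K. K holomorphic_on UNIV \<and> Im (K 0) = 0 \<and> (k \<le> J \<longrightarrow> (\<forall>z. cmod z = 1 \<longrightarrow>
        - ln (1 - 15 / 16 * cmod (expsum (S k) z / 64 ^ k)) \<le> Re (K z) \<and>
        Re (K z) \<le> - ln (1 - 15 / 16 * cmod (expsum (S k) z / 64 ^ k))
          + 1 / (1000 * 64 ^ J * (real J + 1))))" for k
    proof (cases "k \<le> J")
      case True
      have "1 - 15 / 16 * cmod (expsum (S k) z / 64 ^ k) \<noteq> 0" if "z \<in> sphere 0 1" for z
      proof -
        have "cmod (expsum (S k) z / 64 ^ k) \<le> 1"
          using cmod_expsum_le[of z "S k"] S(2)[OF True] that by (simp add: norm_divide norm_power)
        then show ?thesis by linarith
      qed
      then have "continuous_on (sphere 0 1) (\<lambda>z. - ln (1 - 15 / 16 * cmod (expsum (S k) z / 64 ^ k)))"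
        by (intro continuous_intros) auto
      then show ?thesis
        by (rule entire_Re_approx[where \<eta> = "1 / (1000 * 64 ^ J * (real J + 1))"]) auto
    next
      case False
      then show ?thesis
        by (intro exI[of _ "\<lambda>_. 0"]) auto
    qed
    then obtain K where K: "\<And>k. K k holomorphic_on UNIV \<and> Im (K k 0) = 0 \<and> (k \<le> J \<longrightarrow> (\<forall>z. cmod z = 1 \<longrightarrow>
        - ln (1 - 15 / 16 * cmod (expsum (S k) z / 64 ^ k)) \<le> Re (K k z) \<and>
        Re (K k z) \<le> - ln (1 - 15 / 16 * cmod (expsum (S k) z / 64 ^ k))
          + 1 / (1000 * 64 ^ J * (real J + 1))))"
      by metis
    interpret littlewood_blocks A S J K
    proof (rule littlewood_blocks.intro)
      show "finite A" by fact
    qed (use S K in \<open>simp_all\<close>)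
    show ?thesis
      unfolding circle_L1_norm_indicator_hat by (rule circle_mean_cmod_expsum_ge)
  qed
qed

text \<open>The number of blocks is the integer part of \<open>ln (card A) / ln 64\<close>; rounding
  costs the \<open>- 1\<close>. Below \<open>64\<close> elements the left side is at most
  \<open>0\<close>.\<close>

lemma circle_L1_norm_indicator_hat_ge:
  assumes "finite A" "A \<noteq> {}"
  shows "15 / 16 * (78 / 100) * (ln (card A) / ln 64 - 1) \<le> circle_L1_norm (indicator_hat A)"
proof (cases "card A < 64")
  case True
  have "0 \<le> circle_L1_norm (indicator_hat A)"
    unfolding circle_L1_norm_indicator_hat
    using circle_mean_mono[of "\<lambda>_. 0" "\<lambda>z. cmod (expsum A z)"] by (simp add: continuous_intros)
  moreover have "ln (card A) \<le> ln (64::real)"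
    using True assms by (subst ln_le_cancel_iff) (auto simp: card_gt_0_iff)
  then have "ln (card A) / ln 64 \<le> (1::real)"
    by (simp add: divide_le_eq_1)
  then have "15 / 16 * (78 / 100) * (ln (card A) / ln 64 - 1) \<le> (0::real)"
    by (intro mult_nonneg_nonpos) auto
  ultimately show ?thesis
    by (rule order_trans[rotated])
next
  case False
  define n where "n = nat \<lfloor>ln (card A) / ln 64\<rfloor>"
  have "ln 64 \<le> ln (real (card A))"
    using False by (subst ln_le_cancel_iff) auto
  then have n: "real n \<le> ln (card A) / ln 64" "ln (card A) / ln 64 < real n + 1" "1 \<le> n"
  proof -
    have "1 \<le> ln (card A) / ln 64"
      using \<open>ln 64 \<le> ln (real (card A))\<close> by simp
    moreover from this have "real n = of_int \<lfloor>ln (card A) / ln 64\<rfloor>"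
      unfolding n_def by (intro of_nat_nat) linarith
    ultimately show "real n \<le> ln (card A) / ln 64" "ln (card A) / ln 64 < real n + 1" "1 \<le> n"
      by linarith+
  qed
  from n(3) obtain J where J: "n = Suc J"
    by (cases n) auto
  have "real n * ln 64 \<le> ln (real (card A))"
    using n(1) by (simp add: field_simps)
  then have "ln (64 ^ n) \<le> ln (real (card A))"
    by (simp add: ln_realpow)
  then have "(64::real) ^ n \<le> real (card A)"
    using False by (subst (asm) ln_le_cancel_iff) auto
  then have "64 ^ Suc J \<le> card A"
    by (metis J of_nat_le_iff of_nat_numeral of_nat_power)
  from circle_L1_norm_ge_blocks[OF assms(1) this] show ?thesis
    using n(2) J by simp
qed

text \<open>The argument gives any constant below \<open>15 / 16 * (78 / 100) / ln 64 > 0.1755\<close>.\<close>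

theorem theorem1p5:
  shows "\<exists>c::real. 0.170934 \<le> c \<and> c < 0.170935 \<and>
    (\<forall>\<epsilon>>0. \<exists>N\<^sub>0::nat. \<forall>N\<ge>N\<^sub>0. \<forall>A::int set. finite A \<and> card A = N \<longrightarrow>
       circle_L1_norm (indicator_hat A) \<ge> (c - \<epsilon>) * ln (real N))"
proof (intro exI[of _ "0.170934"] conjI allI impI)
  fix \<epsilon> :: real
  assume "0 < \<epsilon>"
  \<comment> \<open>This makes the leading coefficient at least
    \<open>15 / 16 * (78 / 100) * (6 / 25) = 0.1755\<close>.\<close>
  have ln64: "ln (64::real) \<le> 25 / 6"
    using ln_realpow[of "2::real" 6] ln2_le_25_over_36 by simp
  show "\<exists>N\<^sub>0::nat. \<forall>N\<ge>N\<^sub>0. \<forall>A::int set. finite A \<and> card A = N \<longrightarrow>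
       circle_L1_norm (indicator_hat A) \<ge> (0.170934 - \<epsilon>) * ln (real N)"
  \<comment> \<open>The surplus \<open>0.1755 - 0.170934\<close> times \<open>ln N\<close> must
    cover the lost \<open>0.73125\<close>, which holds once \<open>ln N \<ge> 161\<close>. The
    threshold does not depend on \<open>\<epsilon>\<close>.\<close>
  proof (intro exI[of _ "nat \<lceil>exp (200::real)\<rceil>"] allI impI)
    fix N and A :: "int set"
    assume N: "nat \<lceil>exp (200::real)\<rceil> \<le> N" and A: "finite A \<and> card A = N"
    have "exp 200 \<le> real N"
      using N by linarith
    moreover have "0 < real N"
      using calculation exp_gt_zero[of "200::real"] by linarith
    ultimately have lnN: "200 \<le> ln (real N)"
      by (simp add: ln_ge_iff)
    have "A \<noteq> {}"
      using A \<open>0 < real N\<close> by auto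
    have "(0.170934 - \<epsilon>) * ln (real N) \<le> 0.170934 * ln (real N)"
      using \<open>0 < \<epsilon>\<close> lnN by (intro mult_right_mono) auto
    also have "\<dots> \<le> 15 / 16 * (78 / 100) * (ln (real N) / (25 / 6) - 1)"
      using lnN by simp
    also have "\<dots> \<le> 15 / 16 * (78 / 100) * (ln (real N) / ln 64 - 1)"
      using ln64 lnN by (intro mult_left_mono diff_right_mono divide_left_mono) auto
    also have "\<dots> \<le> circle_L1_norm (indicator_hat A)"
      using circle_L1_norm_indicator_hat_ge[of A] A \<open>A \<noteq> {}\<close> by simp
    finally show "(0.170934 - \<epsilon>) * ln (real N) \<le> circle_L1_norm (indicator_hat A)" .
  qed
qed simp_all

end
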